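(* Let $H<\mathrm{GL}(d,\mathbb{R})$, $d\ge2$, be a generalized shearlet dilation group whose scaling subgroup has infinitesimal generator $\mathrm{diag}(1,\lambda_2,\ldots,\lambda_d)$, and let $\lambda_{\max}=\max_{i\ge2}\lambda_i$. If $\lambda_{\max}<1$, then there exists an open subset $\emptyset\ne V\Subset\mathcal{O}$ such that the dual action of $H$ on the orbit $\mathcal{O}$ has the $V$-cone approximation property at $(1,0,\ldots,0)^T\in S^{d-1}\cap\mathcal{O}$.
   Context: For a closed subgroup $H<\mathrm{GL}(d,\mathbb{R})$ let $G=\mathbb{R}^d\rtimes H$ with product $(x,h)(y,g)=(x+hy,hg)$ and quasi-regular representation $[\pi(x,h)f](y)=|\det h|^{-1/2}f(h^{-1}(y-x))$ on $L^2(\mathbb{R}^d)$. $H$ is irreducibly admissible if $\pi$ is an irreducible square-integrable representation; equivalently, the dual action $(\xi,h)\mapsto h^T\xi$ has a single open orbit $\mathcal{O}$, of full measure, with compact stabilizers. Let $T(d,\mathbb{R})$ be the group of upper triangular real $d\times d$ matrices with ones on the diagonal. An irreducibly admissible $H$ is a generalized shearlet dilation group if there are closed subgroups $S,D<H$ such that: (i) $S$ is a connected abelian Lie subgroup of $T(d,\mathbb{R})$; (ii) $D=\{\exp(rY):r\in\mathbb{R}\}$ with $Y$ a diagonal matrix; (iii) every $h\in H$ can be written uniquely as $h=\pm ds$ with $d\in D$, $s\in S$. $D$ is called the scaling subgroup and $Y$ its infinitesimal generator. For such $H$ one has $\mathcal{O}=\mathbb{R}^\times\times\mathbb{R}^{d-1}$.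 $V\Subset\mathcal{O}$ means that the closure of $V$ inside $\mathcal{O}$ is compact. $S^{d-1}\subset\mathbb{R}^d$ is the unit sphere; a $\xi$-neighborhood (for $\xi\in S^{d-1}$) is a relatively open $W\subset S^{d-1}$ containing $\xi$. For $W\subset S^{d-1}$ open and $R>0$: $C(W)=\{r\xi':\xi'\in W,\ r>0\}$, $C(W,R)=C(W)\setminus\overline{B_R}(0)$, with $\overline{B_R}(0)$ the closed Euclidean ball. For nonempty open $W\subset S^{d-1}\cap\mathcal{O}$, $\emptyset\neq V\Subset\mathcal{O}$, $R>0$, with $h^{-T}=(h^{-1})^T$: $$K_i(W,V,R)=\{h\in H:h^{-T}V\subset C(W,R)\},\qquad K_o(W,V,R)=\{h\in H:h^{-T}V\cap C(W,R)\neq\emptyset\}.$$ Cone approximation property. For $\xi\in\mathcal{O}\cap S^{d-1}$ and $\emptyset\ne V\Subset\mathcal{O}$, the dual action has the $V$-cone approximation property at $\xi$ if for all $\xi$-neighborhoods $W\subset S^{d-1}\cap\mathcal{O}$ and all $R>0$ there are $R'>0$ and a $\xi$-neighborhood $W'\subset S^{d-1}\cap\mathcal{O}$ such that $K_o(W',V,R')\subset K_i(W,V,R)$. *)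

theory Defs
  imports "HOL-Analysis.Analysis"
begin

(* The coordinates 1 < 2 < ... < d are the elements of a finite linearly ordered
   index type 'n; d = CARD('n). *)

definition first_coord :: "'n::{finite,linorder}" where
  "first_coord = Min UNIV"


section \<open>Matrix groups\<close>

definition GL :: "(real^'n^'n) set" where
  "GL = {A. invertible A}"

definition matrix_subgroup :: "(real^'n^'n) set \<Rightarrow> bool" where
  "matrix_subgroup H \<longleftrightarrow> H \<subseteq> GL \<and> mat 1 \<in> H \<and>
     (\<forall>A\<in>H. \<forall>B\<in>H. A ** B \<in> H) \<and> (\<forall>A\<in>H. matrix_inv A \<in> H)"

definition closed_matrix_subgroup :: "(real^'n^'n) set \<Rightarrow> bool" where
  "closed_matrix_subgroup H \<longleftrightarrow>
     matrix_subgroup H \<and> closedin (top_of_set GL) H"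

definition unipotent_upper :: "(real^'n::{finite,linorder}^'n::{finite,linorder}) set" where
  "unipotent_upper = {A. (\<forall>i. A $ i $ i = 1) \<and> (\<forall>i j. j < i \<longrightarrow> A $ i $ j = 0)}"

definition diag_matrix :: "('n \<Rightarrow> real) \<Rightarrow> real^'n^'n" where
  "diag_matrix l = (\<chi> i j. if i = j then l i else 0)"

(* The multiplication of the type real^'n^'n is componentwise, so the library
   functions (^) and exp on this type are not the matrix ones. *)

definition matrix_pow :: "real^'n^'n \<Rightarrow> nat \<Rightarrow> real^'n^'n" where
  "matrix_pow A k = (((**) A) ^^ k) (mat 1)"

definition matrix_exp :: "real^'n^'n \<Rightarrow> real^'n^'n" where
  "matrix_exp A = (\<Sum>k. (1 / fact k) *\<^sub>R matrix_pow A k)"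


section \<open>The affine group and its quasi-regular representation\<close>

type_synonym 'n affine = "(real^'n) \<times> (real^'n^'n)"

definition affine_group :: "(real^'n^'n) set \<Rightarrow> 'n::finite affine set" where
  "affine_group H = UNIV \<times> H"

definition affine_mult :: "'n::finite affine \<Rightarrow> 'n::finite affine \<Rightarrow> 'n::finite affine" where
  "affine_mult g k = (fst g + snd g *v fst k, snd g ** snd k)"

definition left_haar_measure :: "(real^'n^'n) set \<Rightarrow> 'n::finite affine measure \<Rightarrow> bool" where
  "left_haar_measure H \<mu> \<longleftrightarrow>
     space \<mu> = affine_group H \<and>
     sets \<mu> = sets (restrict_space borel (affine_group H)) \<and>
     (\<forall>g\<in>affine_group H. \<forall>A\<in>sets \<mu>. emeasure \<mu> (affine_mult g ` A) = emeasure \<mu> A) \<and>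
     (\<forall>K. compact K \<and> K \<subseteq> affine_group H \<longrightarrow> emeasure \<mu> K < \<infinity>) \<and>
     emeasure \<mu> (affine_group H) \<noteq> 0"

(* Elements of the Hilbert space are represented by functions; functions that agree
   almost everywhere represent the same element. *)

definition L2 :: "(real^'n \<Rightarrow> complex) set" where
  "L2 = {f. f \<in> borel_measurable lborel \<and> integrable lborel (\<lambda>x. (cmod (f x))\<^sup>2)}"

definition L2_null :: "(real^'n \<Rightarrow> complex) set" where
  "L2_null = {f \<in> L2. AE x in lborel. f x = 0}"

definition L2_inner :: "(real^'n \<Rightarrow> complex) \<Rightarrow> (real^'n \<Rightarrow> complex) \<Rightarrow> complex" where
  "L2_inner f g = (LINT x|lborel. f x * cnj (g x))"

definition L2_dist :: "(real^'n \<Rightarrow> complex) \<Rightarrow> (real^'n \<Rightarrow> complex) \<Rightarrow> real" where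
  "L2_dist f g = sqrt (LINT x|lborel. (cmod (f x - g x))\<^sup>2)"

(* The last clause (closedness) also makes M saturated with respect to equality
   almost everywhere. *)

definition closed_L2_subspace :: "(real^'n \<Rightarrow> complex) set \<Rightarrow> bool" where
  "closed_L2_subspace M \<longleftrightarrow>
     M \<subseteq> L2 \<and> (\<lambda>x. 0) \<in> M \<and>
     (\<forall>f\<in>M. \<forall>g\<in>M. (\<lambda>x. f x + g x) \<in> M) \<and>
     (\<forall>c. \<forall>f\<in>M. (\<lambda>x. c * f x) \<in> M) \<and>
     (\<forall>f\<in>L2. (\<forall>e>0. \<exists>g\<in>M. L2_dist f g < e) \<longrightarrow> f \<in> M)"

definition quasi_regular ::
  "'n::finite affine \<Rightarrow> (real^'n \<Rightarrow> complex) \<Rightarrow> (real^'n \<Rightarrow> complex)" where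
  "quasi_regular g f = (\<lambda>y. complex_of_real (\<bar>det (snd g)\<bar> powr (- 1 / 2)) *
                            f (matrix_inv (snd g) *v (y - fst g)))"

definition quasi_regular_irreducible :: "(real^'n^'n) set \<Rightarrow> bool" where
  "quasi_regular_irreducible H \<longleftrightarrow>
     (\<forall>M. closed_L2_subspace M \<and> (\<forall>g\<in>affine_group H. \<forall>f\<in>M. quasi_regular g f \<in> M)
          \<longrightarrow> M = L2_null \<or> M = L2)"

definition quasi_regular_square_integrable :: "(real^'n^'n) set \<Rightarrow> bool" where
  "quasi_regular_square_integrable H \<longleftrightarrow>
     (\<exists>\<mu>. left_haar_measure H \<mu> \<and>
        (\<exists>\<psi>\<in>L2 - L2_null.
           integrable \<mu> (\<lambda>g. (cmod (L2_inner \<psi> (quasi_regular g \<psi>)))\<^sup>2)))"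

definition irreducibly_admissible :: "(real^'n^'n) set \<Rightarrow> bool" where
  "irreducibly_admissible H \<longleftrightarrow>
     closed_matrix_subgroup H \<and> quasi_regular_irreducible H \<and>
     quasi_regular_square_integrable H"


section \<open>The dual action\<close>

definition dual_orbit :: "(real^'n^'n) set \<Rightarrow> real^'n \<Rightarrow> (real^'n) set" where
  "dual_orbit H \<xi> = {transpose h *v \<xi> |h. h \<in> H}"

(* A conull orbit meets every nonempty open set, so there is at most one such orbit
   and no other orbit is open. *)

definition open_dual_orbit :: "(real^'n^'n) set \<Rightarrow> (real^'n) set \<Rightarrow> bool" where
  "open_dual_orbit H Orb \<longleftrightarrow>
     (\<exists>\<xi>. Orb = dual_orbit H \<xi>) \<and> open Orb \<and> - Orb \<in> null_sets lborel"


section \<open>Generalized shearlet dilation groups\<close>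

(* A closed subgroup of a closed subgroup of GL is automatically a Lie subgroup. *)

definition shearlet_decomposition ::
  "(real^'n::{finite,linorder}^'n::{finite,linorder}) set \<Rightarrow> (real^'n::{finite,linorder}^'n::{finite,linorder}) set \<Rightarrow> (real^'n::{finite,linorder}^'n::{finite,linorder}) set \<Rightarrow>
   real^'n::{finite,linorder}^'n::{finite,linorder} \<Rightarrow> bool" where
  "shearlet_decomposition H S D Y \<longleftrightarrow>
     closed_matrix_subgroup S \<and> S \<subseteq> H \<and>
     closed_matrix_subgroup D \<and> D \<subseteq> H \<and>
     S \<subseteq> unipotent_upper \<and> connected S \<and> (\<forall>s\<in>S. \<forall>t\<in>S. s ** t = t ** s) \<and>
     (\<forall>i j. i \<noteq> j \<longrightarrow> Y $ i $ j = 0) \<and> D = {matrix_exp (r *\<^sub>R Y) |r. True} \<and>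
     (\<forall>h\<in>H. \<exists>!p. p \<in> {1, - 1 :: real} \<times> D \<times> S \<and>
                  h = fst p *\<^sub>R (fst (snd p) ** snd (snd p)))"

definition shearlet_dilation_group_with_generator ::
  "(real^'n::{finite,linorder}^'n::{finite,linorder}) set \<Rightarrow> real^'n::{finite,linorder}^'n::{finite,linorder} \<Rightarrow> bool" where
  "shearlet_dilation_group_with_generator H Y \<longleftrightarrow>
     irreducibly_admissible H \<and> (\<exists>S D. shearlet_decomposition H S D Y)"


section \<open>Cone approximation\<close>

definition relatively_compact_in :: "(real^'n) set \<Rightarrow> (real^'n) set \<Rightarrow> bool" where
  "relatively_compact_in V Orb \<longleftrightarrow> V \<subseteq> Orb \<and> compact (Orb \<inter> closure V)"

definition sphere_nbhd :: "real^'n \<Rightarrow> (real^'n) set \<Rightarrow> bool" where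
  "sphere_nbhd \<xi> W \<longleftrightarrow> openin (top_of_set (sphere 0 1)) W \<and> \<xi> \<in> W"

definition cone_over :: "(real^'n) set \<Rightarrow> (real^'n) set" where
  "cone_over W = {r *\<^sub>R \<omega> |r \<omega>. \<omega> \<in> W \<and> r > 0}"

definition truncated_cone :: "(real^'n) set \<Rightarrow> real \<Rightarrow> (real^'n) set" where
  "truncated_cone W R = cone_over W - cball 0 R"

definition inv_transpose :: "real^'n^'n \<Rightarrow> real^'n^'n" where
  "inv_transpose h = transpose (matrix_inv h)"

definition K_inner ::
  "(real^'n^'n) set \<Rightarrow> (real^'n) set \<Rightarrow> (real^'n) set \<Rightarrow> real \<Rightarrow> (real^'n^'n) set" where
  "K_inner H W V R = {h \<in> H. (\<lambda>v. inv_transpose h *v v) ` V \<subseteq> truncated_cone W R}"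

definition K_outer ::
  "(real^'n^'n) set \<Rightarrow> (real^'n) set \<Rightarrow> (real^'n) set \<Rightarrow> real \<Rightarrow> (real^'n^'n) set" where
  "K_outer H W V R = {h \<in> H. (\<lambda>v. inv_transpose h *v v) ` V \<inter> truncated_cone W R \<noteq> {}}"

definition cone_approximation_property ::
  "(real^'n^'n) set \<Rightarrow> (real^'n) set \<Rightarrow> (real^'n) set \<Rightarrow> real^'n \<Rightarrow> bool" where
  "cone_approximation_property H Orb V \<xi> \<longleftrightarrow>
     (\<forall>W R. sphere_nbhd \<xi> W \<and> W \<subseteq> Orb \<and> R > 0 \<longrightarrow>
        (\<exists>R' W'. R' > 0 \<and> sphere_nbhd \<xi> W' \<and> W' \<subseteq> Orb \<and>
                 K_outer H W' V R' \<subseteq> K_inner H W V R))"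

end

theory Submission
  imports Defs
begin

text \<open>
  Write $e_j$ for the coordinate vectors, $\delta_r = \mathrm{diag}(e^{r\lambda_1},\ldots,
  e^{r\lambda_d})$ and $T$ for the commutative group of all transposes $s^T$, $s \in S$. It consists
  of lower triangular unipotent matrices, so it preserves the first coordinate, and every
  $h^{-T}$ has the form $\pm \delta_r t$ with $t \in T$.

  The heart of the proof is that $T$ spans a commutative algebra for which $e_1$ is a cyclic
  vector. Let $v$ be a point of the open orbit with $v_1 > 0$. Inside the half space
  $\{x_1 > 0\}$ the orbit of $v$ under $T$ and positive scalars is open, hence it spans the whole
  space (\<open>cone_orbit_eq_orbit_section\<close>, \<open>span_open_eq_UNIV\<close>). Consequently every vector is $X v$ for
  some $X$ commuting with $T$ (\<open>commutant_evaluation_surj\<close>). If $w_1 > 0$ and $w = X v$, then $X$ is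
  triangular with a nonzero constant diagonal, so it is invertible and carries the open orbit of
  $v$ onto that of $w$. All these orbits are open, and connectedness of the half space leaves only
  one of them (\<open>half_space_single_orbit\<close>). This shows that $\mathcal O$ contains the half space,
  in particular $e_1$, without any Lie theory.

  Now choose $X_j$ commuting with $T$ such that $X_j e_1 = e_j$; it is unique, because $T e_1$
  spans. Conjugation by $\delta_r$ preserves $T$, so uniqueness forces
  $\delta_r X_j \delta_{-r} = e^{r(\lambda_j - 1)} X_j$ (\<open>commuting_weight\<close>). With
  $A = \pm\delta_r t$ and $\omega = A e_1$ this gives
  $A e_j = A X_j e_1 = e^{r(\lambda_j-1)} X_j \omega$, and by linearity
  \[ A v = v_1 \omega + O(e^{-\kappa r}\, |v|\, |\omega|), \qquad \kappa = 1 - \lambda_{\max} > 0, \]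
  uniformly in $t$ (\<open>shear_image_asymptotics\<close>).

  Let $V$ be the ball of radius $1/2$ around $e_1$. If one point of $h^{-T} V$ is long and lies in a
  narrow cone around $e_1$, then its first coordinate $\pm e^r v_1$ is large and positive. Thus the
  sign is $+$ and $r$ is large, so all vectors of $h^{-T} V$ are, up to a small relative error,
  multiples of the same $\omega$ with factors between $1/2$ and $3/2$; they are all long and all
  close to the direction of $e_1$ (\<open>narrow_cone_transfer\<close>, \<open>shear_dual_cone_approximation\<close>).
\<close>

section \<open>Diagonal one-parameter groups and matrix algebra\<close>

text \<open>The default rewriting of transposed matrices into row-vector products would hide the
  products of transposes that make up the dual action.\<close>

declare transpose_matrix_vector [simp del]

lemma norm_first_axis: "norm (axis first_coord 1 :: real^'n::{finite,linorder}) = 1"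
  by simp

lemma first_coord_le: "first_coord \<le> (i::'n::{finite,linorder})"
  by (simp add: first_coord_def)

lemma first_coord_less: "i \<noteq> first_coord \<Longrightarrow> first_coord < (i::'n::{finite,linorder})"
  using first_coord_le[of i] by simp

lemma diag_matrix_mult_nth: "(diag_matrix l ** A) $ i $ j = l i * A $ i $ j"
  for A :: "real^'n^'n"
  by (simp add: diag_matrix_def matrix_matrix_mult_def if_distrib[of "\<lambda>x. x * _"] cong: if_cong)

lemma mult_diag_matrix_nth: "(A ** diag_matrix l) $ i $ j = A $ i $ j * l j"
  for A :: "real^'n^'n"
  by (simp add: diag_matrix_def matrix_matrix_mult_def if_distrib[of "\<lambda>x. _ * x"] cong: if_cong)

lemma diag_matrix_vector_nth: "(diag_matrix l *v x) $ i = l i * x $ i"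
  for x :: "real^'n"
  by (simp add: diag_matrix_def matrix_vector_mult_def if_distrib[of "\<lambda>x. x * _"] cong: if_cong)

lemma diag_matrix_nth: "diag_matrix l $ i $ j = (if i = j then l i else 0)"
  by (simp add: diag_matrix_def)

lemma transpose_diag_matrix: "transpose (diag_matrix l) = diag_matrix l"
  by (auto simp: vec_eq_iff transpose_def diag_matrix_nth)

lemma diag_matrix_mult: "diag_matrix l ** diag_matrix m = diag_matrix (\<lambda>i. l i * m i)"
  by (simp add: vec_eq_iff diag_matrix_mult_nth diag_matrix_nth)

lemma diag_matrix_one: "diag_matrix (\<lambda>i. 1) = mat 1"
  by (simp add: vec_eq_iff diag_matrix_nth mat_def)

lemma matrix_pow_diag: "matrix_pow (diag_matrix l) k = diag_matrix (\<lambda>i. l i ^ k)"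
  by (induction k) (simp_all add: matrix_pow_def diag_matrix_one diag_matrix_mult)

definition dilation :: "('n \<Rightarrow> real) \<Rightarrow> real \<Rightarrow> real^'n^'n" where
  "dilation lam r = diag_matrix (\<lambda>i. exp (r * lam i))"

lemma matrix_exp_diag: "matrix_exp (r *\<^sub>R diag_matrix lam) = dilation lam r"
proof -
  have scale: "r *\<^sub>R diag_matrix lam = diag_matrix (\<lambda>i. r * lam i)"
    by (simp add: vec_eq_iff diag_matrix_nth)
  have entry: "(\<lambda>k. (\<Sum>m<k. (1 / fact m) *\<^sub>R diag_matrix (\<lambda>i. (r * lam i) ^ m)) $ i $ j)
      \<longlonglongrightarrow> dilation lam r $ i $ j" for i j
    using exp_converges[of "r * lam i"]
    by (cases "i = j") (simp_all add: sums_def dilation_def diag_matrix_nth divide_inverse sum_component)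
  have "(\<lambda>k. (1 / fact k) *\<^sub>R matrix_pow (r *\<^sub>R diag_matrix lam) k) sums dilation lam r"
    unfolding sums_def scale matrix_pow_diag
    by (intro vec_tendstoI entry)
  then show ?thesis
    unfolding matrix_exp_def by (rule sums_unique[symmetric])
qed

lemma dilation_zero: "dilation lam 0 = mat 1"
  by (simp add: dilation_def diag_matrix_one)

lemma dilation_mult: "dilation lam r ** dilation lam s = dilation lam (r + s)"
  by (simp add: dilation_def diag_matrix_mult exp_add[symmetric] distrib_right)

lemma dilation_vector_nth: "(dilation lam r *v x) $ i = exp (r * lam i) * x $ i"
  by (simp add: dilation_def diag_matrix_vector_nth)

lemma transpose_dilation: "transpose (dilation lam r) = dilation lam r"
  by (simp add: dilation_def transpose_diag_matrix)

lemma matrix_add_rdistrib: "(A + B) ** C = A ** C + B ** C" for A B C :: "real^'n^'n"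
  by (vector matrix_matrix_mult_def sum.distrib[symmetric] field_simps)

lemma matrix_inv_eqI:
  fixes A B :: "real^'n^'n"
  assumes "A ** B = mat 1"
  shows "matrix_inv A = B"
proof -
  have BA: "B ** A = mat 1"
    using assms matrix_left_right_inverse by blast
  have "A ** matrix_inv A = mat 1 \<and> matrix_inv A ** A = mat 1"
    unfolding matrix_inv_def by (rule someI[of _ B]) (simp add: assms BA)
  then show ?thesis
    by (metis assms matrix_mul_assoc matrix_mul_lid matrix_mul_rid)
qed

lemma span_open_eq_UNIV:
  fixes U :: "'a::euclidean_space set"
  assumes "open U" "U \<noteq> {}"
  shows "span U = UNIV"
proof -
  have "\<not> dim U < DIM('a)"
    using empty_interior_lowdim[of U] assms by (auto simp: interior_open)
  then show ?thesis
    using dim_eq_full[of U] dim_subset_UNIV[of U] by linarith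
qed

lemma matrix_vector_mult_axis_expansion:
  fixes A :: "real^'n^'m"
  shows "A *v v = (\<Sum>j\<in>UNIV. v $ j *\<^sub>R (A *v axis j 1))"
proof -
  have "A *v v = A *v (\<Sum>j\<in>UNIV. v $ j *\<^sub>R axis j 1)"
    using basis_expansion[of v] by (simp add: scalar_mult_eq_scaleR)
  then show ?thesis
    by (simp add: linear_sum[OF matrix_vector_mul_linear] matrix_vector_mult_scaleR)
qed

section \<open>Commuting groups of lower unipotent matrices\<close>

definition half_space :: "(real^'n::{finite,linorder}) set" where
  "half_space = {x. x $ first_coord > 0}"

lemma connected_half_space: "connected (half_space :: (real^'n::{finite,linorder}) set)"
  using convex_halfspace_gt[of 0 "axis first_coord 1 :: real^'n::{finite,linorder}"]
  by (intro convex_connected) (simp add: half_space_def inner_axis')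

lemma open_half_space: "open (half_space :: (real^'n::{finite,linorder}) set)"
  using open_halfspace_gt[of 0 "axis first_coord 1 :: real^'n::{finite,linorder}"]
  by (simp add: half_space_def inner_axis')

lemma first_coord_lower:
  fixes A :: "real^'n::{finite,linorder}^'n::{finite,linorder}"
  assumes "\<And>i j. i < j \<Longrightarrow> A $ i $ j = 0"
  shows "(A *v x) $ first_coord = A $ first_coord $ first_coord * x $ first_coord"
proof -
  have "(\<Sum>j\<in>UNIV. A $ first_coord $ j * x $ j) =
      (\<Sum>j\<in>{first_coord}. A $ first_coord $ j * x $ j)"
    by (rule sum.mono_neutral_right) (auto simp: assms first_coord_less)
  then show ?thesis
    by (simp add: matrix_vector_mult_def)
qed

text \<open>To be applied to the group of transposes of the shears, which acts on the frequency side; there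
  it is lower triangular, so that the first coordinate is invariant.\<close>

locale commuting_shears =
  fixes T :: "(real^'n::{finite,linorder}^'n::{finite,linorder}) set"
  assumes one_in: "mat 1 \<in> T"
    and mult_in: "\<And>s t. s \<in> T \<Longrightarrow> t \<in> T \<Longrightarrow> s ** t \<in> T"
    and inverse_in: "\<And>t. t \<in> T \<Longrightarrow> \<exists>s\<in>T. s ** t = mat 1"
    and commute: "\<And>s t. s \<in> T \<Longrightarrow> t \<in> T \<Longrightarrow> s ** t = t ** s"
    and diagonal: "\<And>t i. t \<in> T \<Longrightarrow> t $ i $ i = 1"
    and lower: "\<And>t i j. t \<in> T \<Longrightarrow> i < j \<Longrightarrow> t $ i $ j = 0"
begin

text \<open>The positive scalars are included so that orbits can be open in the whole space rather than
  in an affine hyperplane on which the first coordinate is constant.\<close>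

definition cone_orbit where
  "cone_orbit v = {c *\<^sub>R (t *v v) |c t. c > 0 \<and> t \<in> T}"

text \<open>Besides commuting with the shears, the members are required to share the shape of the linear
  combinations of shears: lower triangular with constant diagonal. This makes invertibility
  readable from a single entry.\<close>

definition commutant where
  "commutant = {X. (\<forall>t\<in>T. X ** t = t ** X) \<and> (\<forall>i j. i < j \<longrightarrow> X $ i $ j = 0) \<and>
     (\<forall>i. X $ i $ i = X $ first_coord $ first_coord)}"

lemma shear_first_coord: "t \<in> T \<Longrightarrow> (t *v x) $ first_coord = x $ first_coord"
  using first_coord_lower[of t x] by (simp add: lower diagonal)

lemma cone_orbit_self: "v \<in> cone_orbit v"
  unfolding cone_orbit_def using one_in by (force intro!: exI[of _ 1] exI[of _ "mat 1"])

lemma cone_orbit_trans: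
  assumes "w \<in> cone_orbit v" shows "cone_orbit w \<subseteq> cone_orbit v"
proof
  fix x assume "x \<in> cone_orbit w"
  then obtain c t where ct: "c > 0" "t \<in> T" "x = c *\<^sub>R (t *v w)" by (auto simp: cone_orbit_def)
  obtain b s where bs: "b > 0" "s \<in> T" "w = b *\<^sub>R (s *v v)" using assms by (auto simp: cone_orbit_def)
  have "x = (c * b) *\<^sub>R ((t ** s) *v v)"
    using ct bs by (simp add: matrix_vector_mult_scaleR matrix_vector_mul_assoc)
  then show "x \<in> cone_orbit v"
    unfolding cone_orbit_def using ct bs mult_in by (force intro!: exI[of _ "c*b"])
qed

lemma cone_orbit_sym:
  assumes "w \<in> cone_orbit v" shows "v \<in> cone_orbit w"
proof -
  obtain b s where bs: "b > 0" "s \<in> T" "w = b *\<^sub>R (s *v v)" using assms by (auto simp: cone_orbit_def)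
  obtain t where t: "t \<in> T" "t ** s = mat 1" using inverse_in bs by blast
  have "(1/b) *\<^sub>R (t *v w) = v"
    using bs t by (simp add: matrix_vector_mult_scaleR matrix_vector_mul_assoc)
  then show ?thesis
    unfolding cone_orbit_def using bs t by (force intro!: exI[of _ "1/b"])
qed

lemma cone_orbit_subset_half_space: "v \<in> half_space \<Longrightarrow> cone_orbit v \<subseteq> half_space"
  by (auto simp: cone_orbit_def half_space_def shear_first_coord)

lemma shears_in_commutant: "T \<subseteq> commutant"
  by (auto simp: commutant_def commute lower diagonal)

lemma commutant_diagonal: "X \<in> commutant \<Longrightarrow> X $ i $ i = X $ first_coord $ first_coord"
  unfolding commutant_def by blast

lemma subspace_commutant: "subspace commutant"
proof (rule subspaceI)
  fix X Y assume X: "X \<in> commutant" and Y: "Y \<in> commutant"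
  have "(X + Y) $ i $ i = (X + Y) $ first_coord $ first_coord" for i
    using commutant_diagonal[OF X, of i] commutant_diagonal[OF Y, of i] by simp
  moreover have "(X + Y) ** t = t ** (X + Y)" if "t \<in> T" for t
  proof -
    have "X ** t = t ** X" "Y ** t = t ** Y"
      using X Y that by (auto simp: commutant_def)
    then show ?thesis
      by (simp add: matrix_add_ldistrib matrix_add_rdistrib)
  qed
  ultimately show "X + Y \<in> commutant"
    using X Y by (simp add: commutant_def)
next
  fix c X assume X: "X \<in> commutant"
  have "(c *\<^sub>R X) $ i $ i = (c *\<^sub>R X) $ first_coord $ first_coord" for i
    using commutant_diagonal[OF X, of i] by simp
  then show "c *\<^sub>R X \<in> commutant"
    using X by (simp add: commutant_def matrix_scalar_ac flip: scalar_matrix_assoc)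
qed (simp add: commutant_def)

text \<open>Triangularity at work: at the first nonzero coordinate of \<open>y\<close>, the vector \<open>X *v y\<close> has that
  coordinate multiplied by the diagonal entry.\<close>

lemma commutant_injective:
  assumes X: "X \<in> commutant" and nz: "X $ first_coord $ first_coord \<noteq> 0"
  shows "inj ((*v) X)"
proof -
  have "y = 0" if y: "X *v y = 0" for y
  proof (rule ccontr)
    assume "y \<noteq> 0"
    define N where "N = {i. y $ i \<noteq> 0}"
    have N: "finite N" "N \<noteq> {}" using \<open>y \<noteq> 0\<close> by (auto simp: N_def vec_eq_iff)
    define k where "k = Min N"
    have k: "k \<in> N" using N by (simp add: k_def)
    have "(\<Sum>j\<in>UNIV. X $ k $ j * y $ j) = (\<Sum>j\<in>{k}. X $ k $ j * y $ j)"
    proof (rule sum.mono_neutral_right; clarsimp)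
      fix j assume "j \<noteq> k" "y $ j \<noteq> 0"
      then have "k < j" using N by (simp add: k_def N_def less_le)
      then show "X $ k $ j = 0" using X by (simp add: commutant_def)
    qed
    moreover have "X $ k $ k = X $ first_coord $ first_coord"
      using X by (rule commutant_diagonal)
    ultimately have "(X *v y) $ k \<noteq> 0"
      using k nz by (simp add: matrix_vector_mult_def N_def)
    then show False using y by simp
  qed
  then show ?thesis
    by (simp add: linear_injective_0)
qed

text \<open>The vectors \<open>X *v v\<close> form a subspace that contains the orbit of \<open>v\<close>, and an open set spans.\<close>

lemma commutant_evaluation_surj:
  assumes "open (cone_orbit v)"
  shows "\<exists>X\<in>commutant. X *v v = w"
proof -
  have "subspace ((\<lambda>X. X *v v) ` commutant)"
    by (intro linear_subspace_image subspace_commutant)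
      (simp add: linear_iff matrix_vector_mult_add_rdistrib scaleR_matrix_vector_assoc)
  moreover have "cone_orbit v \<subseteq> (\<lambda>X. X *v v) ` commutant"
  proof
    fix x assume "x \<in> cone_orbit v"
    then obtain c t where ct: "t \<in> T" "x = (c *\<^sub>R t) *v v"
      by (auto simp: cone_orbit_def scaleR_matrix_vector_assoc)
    then have "c *\<^sub>R t \<in> commutant"
      using shears_in_commutant subspace_commutant by (auto simp: subspace_scale)
    with ct show "x \<in> (\<lambda>X. X *v v) ` commutant" by blast
  qed
  ultimately have "span (cone_orbit v) \<subseteq> (\<lambda>X. X *v v) ` commutant"
    by (simp add: span_minimal)
  moreover have "span (cone_orbit v) = UNIV"
    using assms cone_orbit_self by (intro span_open_eq_UNIV) auto
  ultimately have "w \<in> (\<lambda>X. X *v v) ` commutant" by auto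
  then show ?thesis by blast
qed

lemma cone_orbit_commutant_image:
  assumes "X \<in> commutant"
  shows "cone_orbit (X *v v) = (*v) X ` cone_orbit v"
proof -
  have eq: "c *\<^sub>R (t *v (X *v v)) = X *v (c *\<^sub>R (t *v v))" if "t \<in> T" for c t
    using assms that by (simp add: commutant_def matrix_vector_mul_assoc matrix_vector_mult_scaleR)
  show ?thesis
  proof
    show "cone_orbit (X *v v) \<subseteq> (*v) X ` cone_orbit v"
      using eq unfolding cone_orbit_def by blast
    show "(*v) X ` cone_orbit v \<subseteq> cone_orbit (X *v v)"
      unfolding cone_orbit_def by clarify (use eq in metis)
  qed
qed

text \<open>A member of the commutant that moves \<open>v\<close> to \<open>w\<close> maps orbit onto orbit, and it is invertible
  because both first coordinates are positive.\<close>

lemma cone_orbits_open: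
  assumes op: "open (cone_orbit v)" and v: "v \<in> half_space" and w: "w \<in> half_space"
  shows "open (cone_orbit w)"
proof -
  obtain X where X: "X \<in> commutant" "X *v v = w"
    using commutant_evaluation_surj[OF op] by blast
  have "w $ first_coord = X $ first_coord $ first_coord * v $ first_coord"
    using first_coord_lower[of X v] X by (simp add: commutant_def)
  then have inj: "inj ((*v) X)"
    using commutant_injective[OF X(1)] w unfolding half_space_def by force
  then have "surj ((*v) X)"
    by (simp add: linear_injective_imp_surjective)
  then show ?thesis
    unfolding X(2)[symmetric] cone_orbit_commutant_image[OF X(1)]
    by (intro open_surjective_linear_image op) auto
qed

text \<open>The orbits partition the connected half space into open sets.\<close>

lemma half_space_single_orbit:
  assumes op: "open (cone_orbit v)" and v: "v \<in> half_space" and w: "w \<in> half_space"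
  shows "cone_orbit w = half_space"
proof -
  have "x \<in> cone_orbit w" if x: "x \<in> half_space" for x
  proof (rule connected_equivalence_relation[OF connected_half_space w x, of "\<lambda>a b. b \<in> cone_orbit a"])
    show "\<exists>U. openin (top_of_set half_space) U \<and> a \<in> U \<and> (\<forall>y\<in>U. y \<in> cone_orbit a)"
      if a: "a \<in> half_space" for a
      using cone_orbits_open[OF op v a] cone_orbit_subset_half_space[OF a] cone_orbit_self[of a]
      by (intro exI[of _ "cone_orbit a"]) (auto intro: open_subset)
  qed (use cone_orbit_sym cone_orbit_trans in blast)+
  then show ?thesis
    using cone_orbit_subset_half_space[OF w] by blast
qed

text \<open>The kernel of \<open>Z\<close> is a subspace that contains the orbit of \<open>v\<close>. Hence a matrix that commutes
  with the shears is determined by its value at \<open>v\<close>.\<close>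

lemma commuting_eq_zeroI:
  assumes op: "open (cone_orbit v)"
    and comm: "\<And>t. t \<in> T \<Longrightarrow> Z ** t = t ** Z" and zero: "Z *v v = 0"
  shows "Z = 0"
proof -
  have "Z *v (c *\<^sub>R (t *v v)) = 0" if "t \<in> T" for c t
  proof -
    have "Z *v (t *v v) = t *v (Z *v v)"
      using comm[OF that] by (simp only: matrix_vector_mul_assoc)
    then show ?thesis by (simp add: zero matrix_vector_mult_scaleR)
  qed
  then have "cone_orbit v \<subseteq> {x. Z *v x = 0}"
    by (auto simp: cone_orbit_def)
  moreover have "subspace {x. Z *v x = 0}"
    by (simp add: subspace_def matrix_vector_right_distrib matrix_vector_mult_scaleR)
  moreover have "span (cone_orbit v) = UNIV"
    using op cone_orbit_self by (intro span_open_eq_UNIV) auto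
  ultimately have "\<forall>x. Z *v x = 0"
    using span_minimal by blast
  then show ?thesis
    by (simp add: matrix_eq)
qed

end

section \<open>Grading by the dilations\<close>

text \<open>The openness assumption is supplied by \<open>cone_orbits_open\<close>, which transfers it from an arbitrary
  point of the open orbit to the first coordinate vector.\<close>

locale graded_commuting_shears = commuting_shears T
  for T :: "(real^'n::{finite,linorder}^'n::{finite,linorder}) set" +
  fixes lam :: "'n::{finite,linorder} \<Rightarrow> real"
  assumes normalized: "\<And>r t. t \<in> T \<Longrightarrow> dilation lam r ** t ** dilation lam (- r) \<in> T"
    and lam_first: "lam first_coord = 1"
    and open_axis_orbit: "open (cone_orbit (axis first_coord 1))"
begin

text \<open>Both sides commute with the shears, as the dilations normalize them, and both send the first
  coordinate vector to the same multiple of \<open>axis j 1\<close>; so they agree by \<open>commuting_eq_zeroI\<close>.\<close>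

lemma commuting_weight:
  assumes comm: "\<And>t. t \<in> T \<Longrightarrow> X ** t = t ** X"
    and X: "X *v axis first_coord 1 = axis j 1"
  shows "dilation lam r ** X ** dilation lam (- r) = exp (r * (lam j - 1)) *\<^sub>R X"
proof -
  let ?D = "dilation lam r" and ?E = "dilation lam (- r)"
  have DE: "?D ** ?E = mat 1" "?E ** ?D = mat 1"
    by (simp_all add: dilation_mult dilation_zero)
  define Z where "Z = ?D ** X ** ?E - exp (r * (lam j - 1)) *\<^sub>R X"
  have "Z = 0"
  proof (rule commuting_eq_zeroI[OF open_axis_orbit])
    fix t assume t: "t \<in> T"
    define s where "s = ?E ** t ** ?D"
    have s: "s \<in> T"
      using normalized[OF t, of "- r"] by (simp add: s_def)
    have Et: "?E ** t = s ** ?E" and Ds: "?D ** s = t ** ?D"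
      unfolding s_def using DE by (metis matrix_mul_assoc matrix_mul_lid matrix_mul_rid)+
    have "?D ** X ** ?E ** t = ?D ** (X ** s) ** ?E"
      using Et by (metis matrix_mul_assoc)
    also have "\<dots> = t ** (?D ** X ** ?E)"
      using comm[OF s] Ds by (metis matrix_mul_assoc)
    finally have eq: "?D ** X ** ?E ** t = t ** (?D ** X ** ?E)" .
    have Z: "Z = ?D ** X ** ?E + (- exp (r * (lam j - 1))) *\<^sub>R X"
      by (simp add: Z_def)
    show "Z ** t = t ** Z"
      unfolding Z matrix_add_rdistrib matrix_add_ldistrib eq matrix_scalar_ac
      by (simp only: comm[OF t] flip: scalar_matrix_assoc)
  next
    have E1: "?E *v axis first_coord 1 = exp (- r) *\<^sub>R axis first_coord 1"
      by (simp add: vec_eq_iff dilation_vector_nth axis_def lam_first)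
    have Dj: "?D *v axis j 1 = exp (r * lam j) *\<^sub>R axis j 1"
      by (simp add: vec_eq_iff dilation_vector_nth axis_def)
    have "(?D ** X ** ?E) *v axis first_coord 1 = exp (r * (lam j - 1)) *\<^sub>R axis j 1"
      using E1 X Dj
      by (simp add: matrix_vector_mult_scaleR algebra_simps exp_diff exp_minus divide_inverse
          flip: matrix_vector_mul_assoc)
    then show "Z *v axis first_coord 1 = 0"
      using X by (simp add: Z_def matrix_vector_mult_diff_rdistrib flip: scaleR_matrix_vector_assoc)
  qed
  then show ?thesis by (simp add: Z_def)
qed

text \<open>The other columns of a dilated shear are expressed through its first column. The matrix \<open>X\<close> is
  independent of \<open>r\<close> and \<open>t\<close>, which is the source of all uniformity below.\<close>

lemma axis_image_scaling:
  obtains X where "\<And>r t. t \<in> T \<Longrightarrow> (dilation lam r ** t) *v axis j 1 =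
    exp (r * (lam j - 1)) *\<^sub>R (X *v ((dilation lam r ** t) *v axis first_coord 1))"
proof -
  obtain X where "X \<in> commutant" and Xj: "X *v axis first_coord 1 = axis j 1"
    using commutant_evaluation_surj[OF open_axis_orbit] by blast
  then have comm: "\<And>t. t \<in> T \<Longrightarrow> X ** t = t ** X"
    by (simp add: commutant_def)
  have "(dilation lam r ** t) *v axis j 1 =
    exp (r * (lam j - 1)) *\<^sub>R (X *v ((dilation lam r ** t) *v axis first_coord 1))"
    if t: "t \<in> T" for r t
  proof -
    let ?D = "dilation lam r" and ?E = "dilation lam (- r)"
    have ED: "?E ** ?D = mat 1" by (simp add: dilation_mult dilation_zero)
    have "(?D ** t) *v axis j 1 = (?D ** (t ** X)) *v axis first_coord 1"
      using Xj by (simp flip: matrix_vector_mul_assoc)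
    also have "?D ** (t ** X) = ?D ** X ** t"
      using comm[OF t] by (metis matrix_mul_assoc)
    also have "\<dots> = (?D ** X ** ?E) ** (?D ** t)"
      using ED by (metis matrix_mul_assoc matrix_mul_rid)
    also have "\<dots> = exp (r * (lam j - 1)) *\<^sub>R (X ** (?D ** t))"
      by (simp add: commuting_weight[OF comm Xj] scalar_matrix_assoc)
    finally show ?thesis
      by (simp add: matrix_vector_mul_assoc flip: scaleR_matrix_vector_assoc)
  qed
  then show ?thesis by (rule that)
qed

text \<open>For large \<open>r\<close> all columns but the first are negligible against the first one: expand \<open>v\<close> in
  coordinates and bound each of the matrices from \<open>axis_image_scaling\<close> by its operator norm.\<close>

lemma shear_image_asymptotics:
  assumes gap: "\<And>j. j \<noteq> first_coord \<Longrightarrow> lam j \<le> 1 - \<kappa>"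
  obtains K where "K > 0" "\<And>r t v. r \<ge> 0 \<Longrightarrow> t \<in> T \<Longrightarrow>
    norm ((dilation lam r ** t) *v v - v $ first_coord *\<^sub>R ((dilation lam r ** t) *v axis first_coord 1))
      \<le> K * exp (- (\<kappa> * r)) * norm v * norm ((dilation lam r ** t) *v axis first_coord 1)"
proof -
  have "\<exists>X. \<forall>j. \<forall>r t. t \<in> T \<longrightarrow> (dilation lam r ** t) *v axis j 1 =
    exp (r * (lam j - 1)) *\<^sub>R (X j *v ((dilation lam r ** t) *v axis first_coord 1))"
    by (rule choice) (meson axis_image_scaling)
  then obtain X where X: "\<And>j r t. t \<in> T \<Longrightarrow> (dilation lam r ** t) *v axis j 1 =
    exp (r * (lam j - 1)) *\<^sub>R (X j *v ((dilation lam r ** t) *v axis first_coord 1))"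
    by blast
  define K where "K = (\<Sum>j\<in>UNIV - {first_coord}. onorm ((*v) (X j)))"
  have K: "K \<ge> 0"
    unfolding K_def by (intro sum_nonneg onorm_pos_le) simp
  show ?thesis
  proof (rule that[of "K + 1"])
    fix r :: real and t v assume r: "r \<ge> 0" and t: "t \<in> T"
    let ?A = "dilation lam r ** t" and ?w = "(dilation lam r ** t) *v axis first_coord 1"
    have "?A *v v = v $ first_coord *\<^sub>R ?w + (\<Sum>j\<in>UNIV-{first_coord}. v $ j *\<^sub>R (?A *v axis j 1))"
      by (subst matrix_vector_mult_axis_expansion, subst sum.remove[of _ first_coord]) auto
    then have "norm (?A *v v - v $ first_coord *\<^sub>R ?w) =
        norm (\<Sum>j\<in>UNIV-{first_coord}. v $ j *\<^sub>R (?A *v axis j 1))"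
      by simp
    also have "\<dots> \<le> (\<Sum>j\<in>UNIV-{first_coord}. onorm ((*v) (X j)) * (exp (- (\<kappa> * r)) * norm v * norm ?w))"
    proof (rule sum_norm_le)
      fix j :: 'n assume "j \<in> UNIV - {first_coord}"
      then have "r * (lam j - 1) \<le> r * (- \<kappa>)"
        using gap[of j] r by (intro mult_left_mono) auto
      then have e: "exp (r * (lam j - 1)) \<le> exp (- (\<kappa> * r))"
        by (simp add: mult.commute)
      have "norm (v $ j *\<^sub>R (?A *v axis j 1)) = \<bar>v $ j\<bar> * (exp (r * (lam j - 1)) * norm (X j *v ?w))"
        by (simp add: X[OF t, of r j] abs_mult)
      also have "\<dots> \<le> norm v * (exp (- (\<kappa> * r)) * (onorm ((*v) (X j)) * norm ?w))"
        by (intro mult_mono e component_le_norm_cart onorm mult_nonneg_nonneg onorm_pos_le) auto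
      finally show "norm (v $ j *\<^sub>R (?A *v axis j 1)) \<le>
          onorm ((*v) (X j)) * (exp (- (\<kappa> * r)) * norm v * norm ?w)"
        by (simp add: ac_simps)
    qed
    also have "\<dots> = K * (exp (- (\<kappa> * r)) * norm v * norm ?w)"
      by (simp add: K_def sum_distrib_right)
    also have "\<dots> \<le> (K + 1) * (exp (- (\<kappa> * r)) * norm v * norm ?w)"
      by (intro mult_right_mono) auto
    finally show "norm (?A *v v - v $ first_coord *\<^sub>R ?w) \<le> (K + 1) * exp (- (\<kappa> * r)) * norm v * norm ?w"
      by (simp add: mult.assoc)
  qed (use K in auto)
qed

end

section \<open>Cone estimates\<close>

text \<open>Being near some nonnegative multiple of \<open>e\<close> suffices for being near the multiple of equal
  length, by the reverse triangle inequality.\<close>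

lemma norm_diff_norm_axis_le:
  fixes x e :: "'a::real_normed_vector"
  assumes "norm e = 1" "c \<ge> 0"
  shows "norm (x - norm x *\<^sub>R e) \<le> 2 * norm (x - c *\<^sub>R e)"
proof -
  have "norm (x - norm x *\<^sub>R e) \<le> norm (x - c *\<^sub>R e) + norm ((c - norm x) *\<^sub>R e)"
    using norm_triangle_ineq[of "x - c *\<^sub>R e" "(c - norm x) *\<^sub>R e"] by (simp add: algebra_simps)
  also have "norm ((c - norm x) *\<^sub>R e) = \<bar>norm x - norm (c *\<^sub>R e)\<bar>"
    using assms by simp
  also have "\<dots> \<le> norm (x - c *\<^sub>R e)"
    by (rule norm_triangle_ineq3)
  finally show ?thesis by simp
qed

text \<open>If \<open>w\<close> and \<open>z\<close> are both nearly multiples of \<open>\<omega>\<close>, then nearness of \<open>w\<close> to the ray of \<open>e\<close>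
  passes to \<open>\<omega>\<close> and from there to \<open>z\<close>: the multiple of \<open>e\<close> used for \<open>z\<close> is \<open>b / a * norm w\<close>.
  The constants come from crude triangle inequalities.\<close>

lemma narrow_cone_transfer:
  fixes e \<omega> w z :: "'a::real_normed_vector"
  assumes e: "norm e = 1"
    and a: "1/2 \<le> a" "a \<le> 3/2" and b: "1/2 \<le> b" "b \<le> 3/2"
    and w: "norm (w - a *\<^sub>R \<omega>) \<le> \<eta> * norm \<omega>" and z: "norm (z - b *\<^sub>R \<omega>) \<le> \<eta> * norm \<omega>"
    and \<eta>: "0 \<le> \<eta>" "\<eta> \<le> 1/4" and \<delta>: "0 \<le> \<delta>" "norm (w - norm w *\<^sub>R e) \<le> \<delta> * norm w"
  shows "norm \<omega> \<le> 4 * norm z"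
    and "norm (z - norm z *\<^sub>R e) \<le> (32 * \<eta> + 48 * \<delta>) * norm z"
proof -
  let ?n = "norm \<omega>"
  have \<eta>n: "\<eta> * ?n \<le> ?n / 4"
    using mult_right_mono[OF \<eta>(2), of ?n] by simp
  have "b * ?n = norm (b *\<^sub>R \<omega>)" using b by simp
  also have "\<dots> \<le> norm z + norm (z - b *\<^sub>R \<omega>)"
    using norm_triangle_ineq4[of z "z - b *\<^sub>R \<omega>"] by simp
  finally have "b * ?n \<le> norm z + ?n / 4" using z \<eta>n by linarith
  moreover have "1/2 * ?n \<le> b * ?n" using b by (intro mult_right_mono) auto
  ultimately show nz: "?n \<le> 4 * norm z" by linarith
  have "norm w \<le> norm (a *\<^sub>R \<omega>) + norm (w - a *\<^sub>R \<omega>)"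
    using norm_triangle_ineq[of "a *\<^sub>R \<omega>" "w - a *\<^sub>R \<omega>"] by simp
  moreover have "norm (a *\<^sub>R \<omega>) \<le> 3/2 * ?n" using mult_right_mono[OF a(2), of ?n] a by simp
  ultimately have nw: "norm w \<le> 2 * ?n" using w \<eta>n norm_ge_zero[of \<omega>] by linarith
  have "norm (a *\<^sub>R \<omega> - norm w *\<^sub>R e) \<le> norm (w - norm w *\<^sub>R e) + norm (w - a *\<^sub>R \<omega>)"
    using norm_triangle_ineq4[of "w - norm w *\<^sub>R e" "w - a *\<^sub>R \<omega>"] by simp
  also have "\<dots> \<le> \<delta> * (2 * ?n) + \<eta> * ?n"
    using w \<delta>(2) mult_left_mono[OF nw \<delta>(1)] by linarith
  finally have 1: "norm (a *\<^sub>R \<omega> - norm w *\<^sub>R e) \<le> (\<eta> + 2 * \<delta>) * ?n"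
    by (simp add: algebra_simps)
  have ba: "b / a \<le> 3" "0 \<le> b / a" using a b by (auto simp: field_simps)
  have "(b / a) *\<^sub>R (a *\<^sub>R \<omega> - norm w *\<^sub>R e) = b *\<^sub>R \<omega> - (b / a * norm w) *\<^sub>R e"
    using a by (simp add: algebra_simps)
  then have "norm (b *\<^sub>R \<omega> - (b / a * norm w) *\<^sub>R e) = b / a * norm (a *\<^sub>R \<omega> - norm w *\<^sub>R e)"
    using ba by (metis abs_of_nonneg norm_scaleR)
  also have "\<dots> \<le> 3 * ((\<eta> + 2 * \<delta>) * ?n)"
    by (intro mult_mono ba 1) auto
  finally have "norm (z - (b / a * norm w) *\<^sub>R e) \<le> \<eta> * ?n + 3 * ((\<eta> + 2 * \<delta>) * ?n)"
    using z norm_triangle_ineq[of "z - b *\<^sub>R \<omega>" "b *\<^sub>R \<omega> - (b / a * norm w) *\<^sub>R e"] by simp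
  then have "norm (z - (b / a * norm w) *\<^sub>R e) \<le> (4 * \<eta> + 6 * \<delta>) * ?n"
    by (simp add: algebra_simps)
  also have "\<dots> \<le> (4 * \<eta> + 6 * \<delta>) * (4 * norm z)"
    using nz \<eta> \<delta> by (intro mult_left_mono) auto
  finally have "norm (z - (b / a * norm w) *\<^sub>R e) \<le> (4 * \<eta> + 6 * \<delta>) * (4 * norm z)" .
  moreover have "norm (z - norm z *\<^sub>R e) \<le> 2 * norm (z - (b / a * norm w) *\<^sub>R e)"
    using ba by (intro norm_diff_norm_axis_le e mult_nonneg_nonneg) auto
  ultimately show "norm (z - norm z *\<^sub>R e) \<le> (32 * \<eta> + 48 * \<delta>) * norm z"
    by (simp add: algebra_simps)
qed

lemma mem_cone_over_iff:
  assumes "W \<subseteq> sphere 0 1"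
  shows "x \<in> cone_over W \<longleftrightarrow> x \<noteq> 0 \<and> x /\<^sub>R norm x \<in> W"
proof
  assume "x \<in> cone_over W"
  then obtain r \<omega> where r: "x = r *\<^sub>R \<omega>" "\<omega> \<in> W" "r > 0" by (auto simp: cone_over_def)
  with assms have "norm \<omega> = 1" by auto
  with r show "x \<noteq> 0 \<and> x /\<^sub>R norm x \<in> W" by auto
next
  assume "x \<noteq> 0 \<and> x /\<^sub>R norm x \<in> W"
  then show "x \<in> cone_over W"
    unfolding cone_over_def by (force intro!: exI[of _ "norm x"])
qed

section \<open>Cone approximation for graded shears\<close>

text \<open>The bound \<open>R'\<close> is chosen so that the first coordinate of a long vector in the narrow cone forces
  both the sign and a dilation parameter at least \<open>r0\<close>, from which on the error term of
  \<open>shear_image_asymptotics\<close> is below the tolerance \<open>\<eta>\<close> on the whole ball.\<close>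

lemma (in graded_commuting_shears) shear_dual_cone_approximation:
  assumes form: "\<And>h. h \<in> H \<Longrightarrow>
      \<exists>\<epsilon> r t. \<epsilon> \<in> {1, - 1} \<and> t \<in> T \<and> inv_transpose h = \<epsilon> *\<^sub>R (dilation lam r ** t)"
    and Orb: "half_space \<subseteq> Orb"
    and \<kappa>: "\<kappa> > 0" and gap: "\<And>j. j \<noteq> first_coord \<Longrightarrow> lam j \<le> 1 - \<kappa>"
  shows "cone_approximation_property H Orb (ball (axis first_coord 1) (1/2)) (axis first_coord 1)"
  unfolding cone_approximation_property_def
proof (intro allI impI, elim conjE)
  let ?e = "axis first_coord 1 :: real^'n::{finite,linorder}"
  let ?V = "ball ?e (1/2)"
  fix W R assume W: "sphere_nbhd ?e W" "W \<subseteq> Orb" and R: "R > (0::real)"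
  then have W1: "W \<subseteq> sphere 0 1" "?e \<in> W"
    by (auto simp: sphere_nbhd_def dest: openin_imp_subset)
  from W obtain \<delta> where \<delta>: "\<delta> > 0" "\<And>x. x \<in> sphere 0 1 \<Longrightarrow> dist x ?e < \<delta> \<Longrightarrow> x \<in> W"
    unfolding sphere_nbhd_def openin_euclidean_subtopology_iff by blast
  obtain K where K: "K > 0" "\<And>r t v. r \<ge> 0 \<Longrightarrow> t \<in> T \<Longrightarrow>
    norm ((dilation lam r ** t) *v v - v $ first_coord *\<^sub>R ((dilation lam r ** t) *v ?e))
      \<le> K * exp (- (\<kappa> * r)) * norm v * norm ((dilation lam r ** t) *v ?e)"
    using shear_image_asymptotics[OF gap] by blast
  \<comment> \<open>Tolerances for which the constants of \<open>narrow_cone_transfer\<close> add up to less than \<open>\<delta>\<close>.\<close>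
  define \<eta> where "\<eta> = min (1/4) (\<delta> / 128)"
  define \<delta>' where "\<delta>' = min (1/2) (\<delta> / 200)"
  have \<eta>: "0 < \<eta>" "\<eta> \<le> 1/4" and \<delta>': "0 < \<delta>'" "\<delta>' \<le> 1/2" and sum: "32 * \<eta> + 48 * \<delta>' < \<delta>"
    using \<delta>(1) by (auto simp: \<eta>_def \<delta>'_def min_def)
  \<comment> \<open>From \<open>r0\<close> on, \<open>K * exp (- (\<kappa> * r)) * (3/2) \<le> \<eta>\<close>; the factor \<open>3/2\<close> bounds the norm on the ball.\<close>
  define r0 where "r0 = max 0 (ln (3 * K / (2 * \<eta>)) / \<kappa>)"
  have decay: "K * exp (- (\<kappa> * r)) * (3/2) \<le> \<eta>" if "r \<ge> r0" for r
  proof -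
    have "ln (3 * K / (2 * \<eta>)) \<le> \<kappa> * r"
      using that \<kappa> by (simp add: r0_def field_simps)
    then have "3 * K / (2 * \<eta>) \<le> exp (\<kappa> * r)"
      using K \<eta> by (metis exp_le_cancel_iff exp_ln divide_pos_pos mult_pos_pos zero_less_numeral)
    then show ?thesis
      using \<eta> by (simp add: exp_minus field_simps)
  qed
  \<comment> \<open>The first coordinate of a vector longer than \<open>R'\<close> in the narrow cone exceeds \<open>R' / 2\<close>; dividing by
    \<open>v $ first_coord \<le> 3/2\<close> leaves \<open>exp r > R' / 3\<close>, and the transfer to other vectors costs a factor 4.\<close>
  define R' where "R' = max (12 * R) (3 * exp r0)"
  define W' where "W' = sphere 0 1 \<inter> ball ?e \<delta>'"
  have W'1: "W' \<subseteq> sphere 0 1" by (simp add: W'_def)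
  have "x \<in> half_space" if "x \<in> W'" for x
  proof -
    have "\<bar>(x - ?e) $ first_coord\<bar> \<le> norm (x - ?e)" by (rule component_le_norm_cart)
    also have "\<dots> < \<delta>'" using that by (simp add: W'_def dist_norm norm_minus_commute)
    finally show ?thesis using \<delta>' by (simp add: half_space_def)
  qed
  then have W'2: "W' \<subseteq> Orb" using Orb by blast
  have W'3: "sphere_nbhd ?e W'"
    using \<delta>' by (auto simp: sphere_nbhd_def W'_def intro: openin_open_Int)
  have "h \<in> K_inner H W ?V R" if "h \<in> K_outer H W' ?V R'" for h
  proof -
    have h: "h \<in> H" using that by (simp add: K_outer_def)
    from that obtain v where v: "v \<in> ?V" "inv_transpose h *v v \<in> truncated_cone W' R'"
      unfolding K_outer_def by blast
    obtain \<epsilon> r t where \<epsilon>: "\<epsilon> \<in> {1, - 1}" and t: "t \<in> T"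
      and h_eq: "inv_transpose h = \<epsilon> *\<^sub>R (dilation lam r ** t)"
      using form[OF h] by blast
    define A where "A = inv_transpose h"
    define \<omega> where "\<omega> = A *v ?e"
    define w where "w = A *v v"
    have A1: "(A *v u) $ first_coord = \<epsilon> * exp r * u $ first_coord" for u
      unfolding A_def h_eq
      by (simp add: dilation_vector_nth lam_first shear_first_coord[OF t]
          flip: scaleR_matrix_vector_assoc matrix_vector_mul_assoc)
    have \<omega>1: "\<omega> $ first_coord = \<epsilon> * exp r"
      by (simp add: \<omega>_def A1)
    have V: "1/2 \<le> u $ first_coord" "u $ first_coord \<le> 3/2" "norm u \<le> 3/2" if "u \<in> ?V" for u
    proof -
      have u: "norm (u - ?e) < 1/2" using that by (simp add: dist_norm norm_minus_commute)
      then have "\<bar>(u - ?e) $ first_coord\<bar> < 1/2"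
        using component_le_norm_cart[of "u - ?e" first_coord] by linarith
      then show "1/2 \<le> u $ first_coord" "u $ first_coord \<le> 3/2" by (auto simp: abs_if split: if_splits)
      show "norm u \<le> 3/2" using norm_triangle_ineq[of ?e "u - ?e"] u by simp
    qed
    have nw: "norm w > R'" and w0: "w \<noteq> 0" and "w /\<^sub>R norm w \<in> W'"
      using v(2) mem_cone_over_iff[OF W'1] by (auto simp: truncated_cone_def w_def A_def)
    then have "norm (w /\<^sub>R norm w - ?e) \<le> \<delta>'"
      by (simp add: W'_def dist_norm norm_minus_commute)
    then have "norm w * norm (w /\<^sub>R norm w - ?e) \<le> \<delta>' * norm w"
      by (metis mult.commute mult_right_mono norm_ge_zero)
    moreover have "norm w * norm (w /\<^sub>R norm w - ?e) = norm (w - norm w *\<^sub>R ?e)"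
      using w0 norm_scaleR[of "norm w" "w /\<^sub>R norm w - ?e"] by (simp add: algebra_simps)
    ultimately have w\<delta>: "norm (w - norm w *\<^sub>R ?e) \<le> \<delta>' * norm w" by simp
    also have "\<dots> \<le> norm w / 2" using mult_right_mono[OF \<delta>'(2), of "norm w"] by simp
    finally have "\<bar>(w - norm w *\<^sub>R ?e) $ first_coord\<bar> \<le> norm w / 2"
      using component_le_norm_cart order_trans by blast
    then have "\<bar>w $ first_coord - norm w\<bar> \<le> norm w / 2" by simp
    then have "w $ first_coord \<ge> norm w / 2" by linarith
    then have w1: "\<epsilon> * exp r * v $ first_coord > R' / 2"
      using nw A1[of v] by (simp add: w_def)
    have R'pos: "R' > 0" using R by (simp add: R'_def)
    have "\<epsilon> = 1"
    proof (rule ccontr)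
      assume "\<epsilon> \<noteq> 1"
      then have "\<epsilon> * exp r * v $ first_coord \<le> 0" using \<epsilon> V(1)[OF v(1)] by simp
      then show False using w1 R'pos by linarith
    qed
    then have A_eq: "A = dilation lam r ** t" by (simp add: A_def h_eq)
    have "exp r * v $ first_coord \<le> exp r * (3/2)"
      using V(2)[OF v(1)] by (intro mult_left_mono) auto
    moreover have "exp r * v $ first_coord > R' / 2" using w1 \<open>\<epsilon> = 1\<close> by simp
    ultimately have er: "exp r > R' / 3" by linarith
    then have "exp r \<ge> exp r0" by (simp add: R'_def)
    then have r: "r \<ge> r0" "r \<ge> 0" by (auto simp: r0_def)
    have close: "norm (A *v u - u $ first_coord *\<^sub>R \<omega>) \<le> \<eta> * norm \<omega>" if u: "u \<in> ?V" for u
    proof -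
      have "norm (A *v u - u $ first_coord *\<^sub>R \<omega>) \<le> K * exp (- (\<kappa> * r)) * norm u * norm \<omega>"
        using K(2)[OF r(2) t, of u] by (simp add: A_eq \<omega>_def)
      also have "\<dots> \<le> K * exp (- (\<kappa> * r)) * (3/2) * norm \<omega>"
        using V(3)[OF u] K(1) by (intro mult_right_mono mult_left_mono) auto
      also have "\<dots> \<le> \<eta> * norm \<omega>"
        using decay[OF r(1)] by (intro mult_right_mono) auto
      finally show ?thesis .
    qed
    have "A *v u \<in> truncated_cone W R" if u: "u \<in> ?V" for u
    proof -
      define z where "z = A *v u"
      have transfer: "norm \<omega> \<le> 4 * norm z"
        "norm (z - norm z *\<^sub>R ?e) \<le> (32 * \<eta> + 48 * \<delta>') * norm z"
        using narrow_cone_transfer[OF norm_first_axis V(1,2)[OF v(1)] V(1,2)[OF u]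
            close[OF v(1), folded w_def] close[OF u, folded z_def] _ \<eta>(2) _ w\<delta>] \<eta>(1) \<delta>'(1)
        by simp_all
      have "exp r \<le> norm \<omega>"
        using component_le_norm_cart[of \<omega> first_coord] \<omega>1 \<open>\<epsilon> = 1\<close> by simp
      then have "norm z > R' / 12" using transfer(1) er by linarith
      moreover have "R' / 12 \<ge> R" by (simp add: R'_def)
      ultimately have nz: "norm z > R" by linarith
      then have z0: "norm z > 0" using R by linarith
      have "norm z * norm (z /\<^sub>R norm z - ?e) = norm (z - norm z *\<^sub>R ?e)"
        using z0 norm_scaleR[of "norm z" "z /\<^sub>R norm z - ?e"] by (simp add: algebra_simps)
      also have "\<dots> < norm z * \<delta>"
        using transfer(2) mult_strict_right_mono[OF sum z0] by (simp add: mult.commute)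
      finally have "dist (z /\<^sub>R norm z) ?e < \<delta>"
        using z0 by (simp add: dist_norm)
      then have "z /\<^sub>R norm z \<in> W"
        using z0 by (intro \<delta>(2)) auto
      then show ?thesis
        using mem_cone_over_iff[OF W1(1), of z] nz z0 by (auto simp: truncated_cone_def z_def)
    qed
    then show ?thesis
      using h by (auto simp: K_inner_def A_def)
  qed
  then show "\<exists>R' W'. R' > 0 \<and> sphere_nbhd ?e W' \<and> W' \<subseteq> Orb \<and> K_outer H W' ?V R' \<subseteq> K_inner H W ?V R"
    using R W'2 W'3 by (intro exI[of _ R'] exI[of _ W']) (auto simp: R'_def)
qed

section \<open>The dual orbit of a generalized shearlet dilation group\<close>

lemma matrix_subgroup_inverse:
  assumes "matrix_subgroup G" "h \<in> G"
  obtains k where "k \<in> G" "matrix_inv h = k" "h ** k = mat 1" "k ** h = mat 1"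
proof -
  have "invertible h" using assms by (auto simp: matrix_subgroup_def GL_def)
  then obtain k where k: "h ** k = mat 1" "k ** h = mat 1" by (auto simp: invertible_def)
  moreover have "matrix_inv h = k" by (rule matrix_inv_eqI[OF k(1)])
  moreover have "matrix_inv h \<in> G" using assms by (auto simp: matrix_subgroup_def)
  ultimately show ?thesis using that by blast
qed

lemma dual_orbit_transitive:
  assumes "matrix_subgroup H" "x \<in> dual_orbit H \<xi>"
  shows "dual_orbit H x = dual_orbit H \<xi>"
proof -
  obtain k where k: "k \<in> H" "x = transpose k *v \<xi>"
    using assms(2) by (auto simp: dual_orbit_def)
  obtain l where l: "l \<in> H" "k ** l = mat 1"
    by (rule matrix_subgroup_inverse[OF assms(1) k(1)])
  have mult: "\<And>A B. A \<in> H \<Longrightarrow> B \<in> H \<Longrightarrow> A ** B \<in> H"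
    using assms(1) by (simp add: matrix_subgroup_def)
  have act: "transpose h *v x = transpose (k ** h) *v \<xi>" for h
    by (simp add: k matrix_transpose_mul matrix_vector_mul_assoc)
  show ?thesis
  proof
    show "dual_orbit H x \<subseteq> dual_orbit H \<xi>"
      using act mult k(1) unfolding dual_orbit_def by blast
    have "transpose h *v \<xi> = transpose (l ** h) *v x" for h
      by (simp add: act matrix_mul_assoc l(2))
    then show "dual_orbit H \<xi> \<subseteq> dual_orbit H x"
      using mult l(1) unfolding dual_orbit_def by blast
  qed
qed

text \<open>The open orbit could a priori lie on one side of the hyperplane where the first coordinate
  vanishes, in case the signs in the decomposition are all positive; it does not, since its
  complement has measure zero.\<close>

lemma conull_meets_half_space:
  fixes Orb :: "(real^'n::{finite,linorder}) set"
  assumes "- Orb \<in> null_sets lborel"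
  shows "\<exists>v\<in>Orb. v \<in> half_space"
proof (rule ccontr)
  assume "\<not> ?thesis"
  then have "half_space \<subseteq> - Orb" by blast
  moreover have "negligible (- Orb)"
    using assms by (simp add: negligible_iff_null_sets null_sets_completionI)
  ultimately have "negligible (half_space :: (real^'n::{finite,linorder}) set)"
    by (rule negligible_subset[rotated])
  moreover have "open (half_space :: (real^'n::{finite,linorder}) set)"
    by (rule open_half_space)
  moreover have "axis first_coord 1 \<in> (half_space :: (real^'n::{finite,linorder}) set)"
    by (simp add: half_space_def)
  ultimately show False using open_not_negligible by blast
qed

text \<open>The algebraic content of a generalized shearlet dilation group, with the scaling subgroup
  written out as dilations.\<close>

locale shearlet_structure =
  fixes H S :: "(real^'n::{finite,linorder}^'n::{finite,linorder}) set"
    and lam :: "'n::{finite,linorder} \<Rightarrow> real"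
  assumes subgroup_H: "matrix_subgroup H" and subgroup_S: "matrix_subgroup S"
    and S_subset: "S \<subseteq> H" and S_unipotent: "S \<subseteq> unipotent_upper"
    and S_commute: "\<And>s t. s \<in> S \<Longrightarrow> t \<in> S \<Longrightarrow> s ** t = t ** s"
    and dilation_in: "\<And>r. dilation lam r \<in> H"
    and decompose: "\<And>h. h \<in> H \<Longrightarrow>
      \<exists>\<epsilon> r s. \<epsilon> \<in> {1, - 1} \<and> s \<in> S \<and> h = \<epsilon> *\<^sub>R (dilation lam r ** s)"
    and lam_first: "lam first_coord = 1"
begin

lemma mult_in_H: "g \<in> H \<Longrightarrow> h \<in> H \<Longrightarrow> g ** h \<in> H"
  using subgroup_H by (simp add: matrix_subgroup_def)

sublocale commuting_shears "transpose ` S"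
proof
  show "mat 1 \<in> transpose ` S"
    using subgroup_S by (intro image_eqI[of _ _ "mat 1"]) (simp_all add: matrix_subgroup_def)
  show "s ** t \<in> transpose ` S" if "s \<in> transpose ` S" "t \<in> transpose ` S" for s t
  proof -
    from that obtain a b where "a \<in> S" "b \<in> S" "s = transpose a" "t = transpose b" by blast
    then show ?thesis
      using subgroup_S
      by (intro image_eqI[of _ _ "b ** a"]) (simp_all add: matrix_subgroup_def matrix_transpose_mul)
  qed
  show "s ** t = t ** s" if "s \<in> transpose ` S" "t \<in> transpose ` S" for s t
  proof -
    from that obtain a b where "a \<in> S" "b \<in> S" "s = transpose a" "t = transpose b" by blast
    then show ?thesis
      using S_commute[of a b] by (simp flip: matrix_transpose_mul)
  qed
  show "\<exists>s\<in>transpose ` S. s ** t = mat 1" if "t \<in> transpose ` S" for t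
  proof -
    from that obtain s where s: "s \<in> S" "t = transpose s" by blast
    obtain k where "k \<in> S" "s ** k = mat 1"
      by (rule matrix_subgroup_inverse[OF subgroup_S s(1)])
    then show ?thesis
      using s by (intro bexI[of _ "transpose k"]) (simp_all flip: matrix_transpose_mul)
  qed
qed (use S_unipotent in \<open>auto simp: unipotent_upper_def transpose_def\<close>)

text \<open>The first diagonal entry of \<open>\<epsilon> *\<^sub>R (dilation lam r ** s)\<close> is \<open>\<epsilon> * exp r\<close>, so it determines
  the sign and the dilation.\<close>

lemma diagonal_one_in_S:
  assumes "h \<in> H" "h $ first_coord $ first_coord = 1"
  shows "h \<in> S"
proof -
  obtain \<epsilon> r s where \<epsilon>: "\<epsilon> \<in> {1, - 1}" "s \<in> S" "h = \<epsilon> *\<^sub>R (dilation lam r ** s)"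
    using decompose[OF assms(1)] by blast
  have "s $ first_coord $ first_coord = 1" using S_unipotent \<epsilon>(2) by (auto simp: unipotent_upper_def)
  then have "\<epsilon> * exp r = 1"
    using assms(2) \<epsilon>(3) by (simp add: dilation_def diag_matrix_mult_nth lam_first)
  moreover have "\<epsilon> * exp r < 0" if "\<epsilon> = - 1" using that by simp
  ultimately have "\<epsilon> = 1" using \<epsilon>(1) by force
  with \<open>\<epsilon> * exp r = 1\<close> have "r = 0" by simp
  then show ?thesis using \<epsilon>(2,3) \<open>\<epsilon> = 1\<close> by (simp add: dilation_zero)
qed

text \<open>Conjugation by a dilation keeps an element of \<open>S\<close> inside the group and leaves its diagonal
  unchanged, so \<open>diagonal_one_in_S\<close> applies.\<close>

lemma transpose_S_normalized:
  assumes "t \<in> transpose ` S"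
  shows "dilation lam r ** t ** dilation lam (- r) \<in> transpose ` S"
proof -
  obtain s where s: "s \<in> S" "t = transpose s" using assms by fast
  let ?h = "dilation lam (- r) ** s ** dilation lam r"
  have "s $ first_coord $ first_coord = 1" using S_unipotent s(1) by (auto simp: unipotent_upper_def)
  then have "?h \<in> S"
    using s S_subset
    by (intro diagonal_one_in_S mult_in_H dilation_in)
      (auto simp: dilation_def diag_matrix_mult_nth mult_diag_matrix_nth simp flip: exp_add)
  moreover have "dilation lam r ** t ** dilation lam (- r) = transpose ?h"
    by (simp add: s matrix_transpose_mul transpose_dilation matrix_mul_assoc)
  ultimately show ?thesis by blast
qed

lemma inv_transpose_form:
  assumes "h \<in> H"
  shows "\<exists>\<epsilon> r t. \<epsilon> \<in> {1, - 1} \<and> t \<in> transpose ` S \<and> inv_transpose h = \<epsilon> *\<^sub>R (dilation lam r ** t)"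
proof -
  obtain \<epsilon> r s where \<epsilon>: "\<epsilon> \<in> {1, - 1}" "s \<in> S" "h = \<epsilon> *\<^sub>R (dilation lam r ** s)"
    using decompose[OF assms] by blast
  obtain k where k: "k \<in> S" "s ** k = mat 1"
    by (rule matrix_subgroup_inverse[OF subgroup_S \<epsilon>(2)])
  have "(dilation lam r ** s) ** (k ** dilation lam (- r)) = dilation lam r ** (s ** k) ** dilation lam (- r)"
    by (simp only: matrix_mul_assoc)
  also have "\<dots> = mat 1"
    by (simp add: k(2) dilation_mult dilation_zero)
  finally have "(dilation lam r ** s) ** (k ** dilation lam (- r)) = mat 1" .
  then have "h ** (\<epsilon> *\<^sub>R (k ** dilation lam (- r))) = mat 1"
    using \<epsilon>(1) by (auto simp: \<epsilon>(3) matrix_scalar_ac simp flip: scalar_matrix_assoc)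
  then have "inv_transpose h = \<epsilon> *\<^sub>R (dilation lam (- r) ** transpose k)"
    by (simp add: inv_transpose_def matrix_inv_eqI transpose_scalar matrix_transpose_mul transpose_dilation)
  then show ?thesis using k(1) \<epsilon>(1) by blast
qed

text \<open>Rescaling \<open>x\<close> to the first coordinate of \<open>v\<close> reduces the claim to points of the dual orbit on
  the same hyperplane as \<open>v\<close>; a group element joining two such points has first diagonal entry
  one, hence is a shear. This description shows that openness of the dual orbit is inherited by
  the orbit of the shears.\<close>

lemma cone_orbit_eq_orbit_section:
  assumes v: "v \<in> half_space"
  shows "cone_orbit v =
    half_space \<inter> (\<lambda>x. (v $ first_coord / x $ first_coord) *\<^sub>R x) -` dual_orbit H v"
proof (intro equalityI subsetI)
  fix x assume x: "x \<in> cone_orbit v"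
  then obtain c s where c: "c > 0" "s \<in> S" "x = c *\<^sub>R (transpose s *v v)"
    by (auto simp: cone_orbit_def)
  then have "(v $ first_coord / x $ first_coord) *\<^sub>R x = transpose s *v v"
    using shear_first_coord[of "transpose s" v] v by (simp add: half_space_def)
  then show "x \<in> half_space \<inter> (\<lambda>x. (v $ first_coord / x $ first_coord) *\<^sub>R x) -` dual_orbit H v"
    using x cone_orbit_subset_half_space[OF v] c(2) S_subset by (auto simp: dual_orbit_def)
next
  fix x assume "x \<in> half_space \<inter> (\<lambda>x. (v $ first_coord / x $ first_coord) *\<^sub>R x) -` dual_orbit H v"
  then obtain h where x: "x \<in> half_space" and h: "h \<in> H"
    and eq: "(v $ first_coord / x $ first_coord) *\<^sub>R x = transpose h *v v"
    by (auto simp: dual_orbit_def)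
  obtain \<epsilon> r s where \<epsilon>: "\<epsilon> \<in> {1, - 1}" "s \<in> S" "h = \<epsilon> *\<^sub>R (dilation lam r ** s)"
    using decompose[OF h] by blast
  have "(transpose h *v v) $ first_coord = h $ first_coord $ first_coord * v $ first_coord"
  proof -
    have "transpose h $ i $ j = 0" if "i < j" for i j
      using \<epsilon> that S_unipotent
      by (auto simp: transpose_def dilation_def diag_matrix_mult_nth unipotent_upper_def)
    from first_coord_lower[OF this, of v] show ?thesis by (simp add: transpose_def)
  qed
  then have "h $ first_coord $ first_coord = 1"
    using arg_cong[OF eq, of "\<lambda>y. y $ first_coord"] x v by (simp add: half_space_def)
  then have "h \<in> S" using diagonal_one_in_S[OF h] by blast
  moreover have "x = (x $ first_coord / v $ first_coord) *\<^sub>R (transpose h *v v)"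
    using x v by (simp add: half_space_def flip: eq)
  moreover have "x $ first_coord / v $ first_coord > 0"
    using x v by (simp add: half_space_def)
  ultimately show "x \<in> cone_orbit v"
    unfolding cone_orbit_def by blast
qed

lemma open_cone_orbit:
  assumes v: "v \<in> half_space" and op: "open (dual_orbit H v)"
  shows "open (cone_orbit v)"
  unfolding cone_orbit_eq_orbit_section[OF v]
  by (intro continuous_open_preimage op open_half_space continuous_intros)
    (auto simp: half_space_def)

text \<open>A dilation moves \<open>x\<close> to the first coordinate of \<open>v\<close>, and there the shears act transitively.\<close>

lemma half_space_subset_orbit:
  assumes v: "v \<in> half_space" and op: "open (dual_orbit H v)"
  shows "half_space \<subseteq> dual_orbit H v"
proof
  fix x :: "real^'n::{finite,linorder}" assume x: "x \<in> half_space"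
  define r where "r = ln (x $ first_coord / v $ first_coord)"
  define y where "y = dilation lam (- r) *v x"
  have er: "exp r = x $ first_coord / v $ first_coord"
    using x v by (simp add: r_def half_space_def)
  have y1: "y $ first_coord = v $ first_coord"
    using x v by (simp add: y_def dilation_vector_nth lam_first exp_minus er half_space_def)
  then have "y \<in> cone_orbit v"
    using half_space_single_orbit[OF open_cone_orbit[OF v op] v v] v by (simp add: half_space_def)
  then have "y \<in> dual_orbit H v"
    using v y1 by (auto simp: cone_orbit_eq_orbit_section[OF v] half_space_def)
  moreover have "x = transpose (dilation lam r) *v y"
    by (simp add: y_def transpose_dilation matrix_vector_mul_assoc dilation_mult dilation_zero)
  moreover have "x \<in> dual_orbit H y"
    using calculation(2) dilation_in[of r] by (auto simp: dual_orbit_def)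
  ultimately show "x \<in> dual_orbit H v"
    using dual_orbit_transitive[OF subgroup_H] by blast
qed

end

lemma shearlet_structureI:
  assumes "shearlet_decomposition H S D (diag_matrix lam)" "matrix_subgroup H"
    and "lam first_coord = 1"
  shows "shearlet_structure H S lam"
proof
  note dec = assms(1)[unfolded shearlet_decomposition_def matrix_exp_diag]
  have D: "D = {dilation lam r |r. True}"
    using dec by (elim conjE)
  have DH: "D \<subseteq> H"
    using dec by (elim conjE)
  show "dilation lam r \<in> H" for r
    using D DH by blast
  have ex: "\<forall>h\<in>H. \<exists>!p. p \<in> {1, - 1 :: real} \<times> D \<times> S \<and>
      h = fst p *\<^sub>R (fst (snd p) ** snd (snd p))"
    using dec by (elim conjE)
  show "\<exists>\<epsilon> r s. \<epsilon> \<in> {1, - 1} \<and> s \<in> S \<and> h = \<epsilon> *\<^sub>R (dilation lam r ** s)" if "h \<in> H" for h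
  proof -
    from ex1_implies_ex[OF bspec[OF ex that]]
    obtain \<epsilon> d s where "\<epsilon> \<in> {1, - 1 :: real}" "d \<in> D" "s \<in> S" "h = \<epsilon> *\<^sub>R (d ** s)"
      by (auto simp only: mem_Times_iff)
    then show ?thesis unfolding D by blast
  qed
  show "matrix_subgroup S"
    using dec by (simp add: closed_matrix_subgroup_def)
  show "s ** t = t ** s" if "s \<in> S" "t \<in> S" for s t
    using dec that by simp
  show "S \<subseteq> H"
    using dec by (elim conjE)
  show "S \<subseteq> unipotent_upper"
    using dec by (elim conjE)
qed (use assms in simp_all)

section \<open>Cone approximation for generalized shearlet dilation groups\<close>

theorem proposition30:
  fixes H :: "(real^'n::{finite,linorder}^'n::{finite,linorder}) set"
    and Orb :: "(real^'n::{finite,linorder}) set"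
    and lam :: "'n::{finite,linorder} \<Rightarrow> real"
  assumes "CARD('n) \<ge> 2"
    and "lam first_coord = 1"
    and "shearlet_dilation_group_with_generator H (diag_matrix lam)"
    and "open_dual_orbit H Orb"
    and "Max (lam ` (UNIV - {first_coord})) < 1"
  shows "axis first_coord 1 \<in> sphere 0 1 \<inter> Orb \<and>
         (\<exists>V. open V \<and> V \<noteq> {} \<and> relatively_compact_in V Orb \<and>
              cone_approximation_property H Orb V (axis first_coord 1))"
proof -
  let ?e = "axis first_coord 1 :: real^'n::{finite,linorder}"
  obtain S D where S: "shearlet_decomposition H S D (diag_matrix lam)" "matrix_subgroup H"
    using assms(3) by (auto simp: shearlet_dilation_group_with_generator_def
        irreducibly_admissible_def closed_matrix_subgroup_def)
  interpret shearlet_structure H S lam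
    by (rule shearlet_structureI[OF S assms(2)])
  have open_Orb: "open Orb" and conull: "- Orb \<in> null_sets lborel"
    using assms(4) by (simp_all add: open_dual_orbit_def)
  obtain v where v: "v \<in> Orb" "v \<in> half_space"
    using conull_meets_half_space[OF conull] by blast
  then have Orb: "Orb = dual_orbit H v"
    using assms(4) dual_orbit_transitive[OF S(2)] by (auto simp: open_dual_orbit_def)
  then have op: "open (dual_orbit H v)" using open_Orb by simp
  have half: "half_space \<subseteq> Orb"
    using half_space_subset_orbit[OF v(2) op] Orb by simp
  have e: "?e \<in> half_space" by (simp add: half_space_def)
  interpret graded_commuting_shears "transpose ` S" lam
    using cone_orbits_open[OF open_cone_orbit[OF v(2) op] v(2) e]
    by unfold_locales (simp_all add: transpose_S_normalized lam_first)
  define \<kappa> where "\<kappa> = 1 - Max (lam ` (UNIV - {first_coord}))"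
  have \<kappa>: "\<kappa> > 0" using assms(5) by (simp add: \<kappa>_def)
  have gap: "lam j \<le> 1 - \<kappa>" if "j \<noteq> first_coord" for j
    using that by (auto simp: \<kappa>_def intro!: Max_ge)
  have "cball ?e (1/2) \<subseteq> half_space"
  proof
    fix x assume "x \<in> cball ?e (1/2)"
    then have "\<bar>(x - ?e) $ first_coord\<bar> \<le> 1/2"
      using component_le_norm_cart[of "x - ?e" first_coord]
      by (simp add: dist_norm norm_minus_commute)
    then show "x \<in> half_space" by (simp add: half_space_def abs_if split: if_splits)
  qed
  then have cball: "cball ?e (1/2) \<subseteq> Orb" using half by blast
  then have "relatively_compact_in (ball ?e (1/2)) Orb"
    using ball_subset_cball[of ?e "1/2"] by (auto simp: relatively_compact_in_def Int_absorb1)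
  moreover have "cone_approximation_property H Orb (ball ?e (1/2)) ?e"
    using inv_transpose_form half \<kappa> gap by (rule shear_dual_cone_approximation)
  moreover have "?e \<in> sphere 0 1 \<inter> Orb"
    using e half by auto
  moreover have "open (ball ?e (1/2))" "ball ?e (1/2) \<noteq> {}"
    by simp_all
  ultimately show ?thesis by blast
qed

end
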